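(* Let $A\in\mathbb{R}^{n\times n}$ be symmetric and let $$A Q_m = Q_m T_m + q_{i+1} b_m^{\mathsf T} + F_m,\qquad Q_{m+1}^{\mathsf T}F_m = 0,\qquad Q_{m+1}:=[Q_m,\,q_{i+1}],$$ be a Krylov-like decomposition. Let $V_\ell\in\mathbb{R}^{m\times \ell}$, with $\ell<m$, be an orthonormal matrix and set $\widetilde Q_\ell := Q_m V_\ell\in\mathbb{R}^{n\times \ell}$. Then $$A\widetilde Q_\ell = \widetilde Q_\ell\widetilde T_\ell + q_{i+1}\widetilde b_\ell^{\mathsf T}+\widetilde F_\ell\qquad\text{and}\qquad \widetilde Q_{\ell+1}^{\mathsf T}\widetilde F_\ell = 0,$$ where $$\widetilde Q_{\ell+1}=[\widetilde Q_\ell,\,q_{i+1}],\quad \widetilde T_\ell = V_\ell^{\mathsf T}T_mV_\ell,\quad \widetilde b_\ell = V_\ell^{\mathsf T}b_m,\quad \widetilde F_\ell = Q_m(I-V_\ell V_\ell^{\mathsf T})T_mV_\ell+F_mV_\ell .$$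
   Context: A matrix $Q$ is called orthonormal if its columns are orthonormal, i.e. $Q^{\mathsf T}Q=I$. Krylov-like decomposition of a symmetric matrix $A\in\mathbb{R}^{n\times n}$: matrices $Q_m\in\mathbb{R}^{n\times m}$, $T_m\in\mathbb{R}^{m\times m}$, $F_m\in\mathbb{R}^{n\times m}$ and vectors $q_{i+1}\in\mathbb{R}^n$, $b_m\in\mathbb{R}^m$ such that $AQ_m=Q_mT_m+q_{i+1}b_m^{\mathsf T}+F_m$ and $Q_{m+1}^{\mathsf T}F_m=0$, where $Q_{m+1}=[Q_m,q_{i+1}]$ has orthonormal columns, $T_m$ is symmetric (not necessarily tridiagonal), and $b_m$ is a general vector. The vector $q_{i+1}$, with $i\ge m$, is a vector from the Lanczos process for $A$, i.e. from the sequence generated from a unit vector $q_1$ by $q_{j+1}=\beta_j^{-1}(Aq_j-\alpha_jq_j-\beta_{j-1}q_{j-1})$ with $\alpha_j=q_j^{\mathsf T}Aq_j$, $\beta_0q_0=0$, and $\beta_j\neq0$ normalizing $q_{j+1}$ to norm one. *)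

theory Defs
  imports Complex_Main "Jordan_Normal_Form.Matrix"
begin

definition orthonormal_mat :: "real mat \<Rightarrow> bool" where
  "orthonormal_mat Q \<longleftrightarrow> transpose_mat Q * Q = 1\<^sub>m (dim_col Q)"

definition vec_norm :: "real vec \<Rightarrow> real" where
  "vec_norm v = sqrt (v \<bullet> v)"

definition append_col :: "real mat \<Rightarrow> real vec \<Rightarrow> real mat" where
  "append_col Q v = mat_of_cols (dim_row Q) (cols Q @ [v])"

definition outer_product :: "real vec \<Rightarrow> real vec \<Rightarrow> real mat" where
  "outer_product u v = mat_of_cols (dim_vec u) [u] * mat_of_rows (dim_vec v) [v]"

text \<open>
  The first \<open>k\<close> steps of the Lanczos process for \<open>A\<close>, producing
  \<open>q 1, \<dots>, q (k + 1)\<close>. The value \<open>q 0\<close> is relevant only through the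
  convention that \<open>\<beta> 0 q 0\<close> is the zero vector. As usual, only the
  magnitude of \<open>\<beta> j\<close> is determined by the normalization, not its sign.
\<close>
definition lanczos_process :: "nat \<Rightarrow> real mat \<Rightarrow> nat \<Rightarrow> (nat \<Rightarrow> real vec) \<Rightarrow> bool" where
  "lanczos_process n A k q \<longleftrightarrow>
     q 1 \<in> carrier_vec n \<and> vec_norm (q 1) = 1 \<and>
     (\<exists>\<alpha> \<beta> :: nat \<Rightarrow> real.
        \<beta> 0 \<cdot>\<^sub>v q 0 = 0\<^sub>v n \<and>
        (\<forall>j\<in>{1..k}.
           \<alpha> j = q j \<bullet> (A *\<^sub>v q j) \<and>
           \<beta> j \<noteq> 0 \<and>
           q (j + 1) = inverse (\<beta> j) \<cdot>\<^sub>v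
             (A *\<^sub>v q j - \<alpha> j \<cdot>\<^sub>v q j - \<beta> (j - 1) \<cdot>\<^sub>v q (j - 1)) \<and>
           vec_norm (q (j + 1)) = 1))"

definition krylov_like_decomposition ::
  "nat \<Rightarrow> nat \<Rightarrow> nat \<Rightarrow> real mat \<Rightarrow> real mat \<Rightarrow> real mat \<Rightarrow> (nat \<Rightarrow> real vec) \<Rightarrow> real vec \<Rightarrow> real mat \<Rightarrow> bool"
  where
  "krylov_like_decomposition n m i A Q T q b F \<longleftrightarrow>
     A \<in> carrier_mat n n \<and> transpose_mat A = A \<and>
     Q \<in> carrier_mat n m \<and>
     T \<in> carrier_mat m m \<and> transpose_mat T = T \<and>
     b \<in> carrier_vec m \<and>
     F \<in> carrier_mat n m \<and>
     m \<le> i \<and> lanczos_process n A i q \<and>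
     orthonormal_mat (append_col Q (q (i + 1))) \<and>
     A * Q = Q * T + outer_product (q (i + 1)) b + F \<and>
     transpose_mat (append_col Q (q (i + 1))) * F = 0\<^sub>m (m + 1) m"

end

theory Submission
  imports Defs
begin

text \<open>Write v for q_(i+1). Multiplying the decomposition on the right by V gives A Q V = Q T V
  + v (V^T b)^T + F V. The columns of T V need not lie in the range of V, so T V is split as V (V^T
  T V) + W, where W = (I - V V^T) T V. The first part contributes the product of the new Q and the
  new T, and Q W joins F V in the new remainder. Orthogonality: since Q^T Q = I and Q^T F = 0, Q^T
  maps the new remainder to W, and V^T W = 0 because V^T V = I. The row for v vanishes because v is
  orthogonal to the columns of Q and of F. \<open>orthonormal_append_colD\<close> supplies the
  relations among Q and v, \<open>transpose_append_col_mult_eq_0_iff\<close> passes between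
  orthogonality to [Q, v] and to its two blocks, and \<open>outer_product_mult\<close> moves V into
  the rank-one term.\<close>

lemma append_col_carrier:
  assumes "Q \<in> carrier_mat n m"
  shows "append_col Q v \<in> carrier_mat n (m + 1)"
  using assms unfolding append_col_def by (intro carrier_matI) auto

lemma col_append_col:
  assumes Q: "Q \<in> carrier_mat n m" and v: "v \<in> carrier_vec n" and k: "k < m + 1"
  shows "col (append_col Q v) k = (if k < m then col Q k else v)"
proof -
  have "(cols Q @ [v]) ! k = (if k < m then col Q k else v)"
    using Q k by (auto simp: nth_append less_Suc_eq)
  moreover have "(cols Q @ [v]) ! k \<in> carrier_vec (dim_row Q)"
    using calculation Q v by auto
  ultimately show ?thesis
    using Q k unfolding append_col_def by (subst col_mat_of_cols) auto
qed

text \<open>Serves in both directions: to split the hypothesis on \<open>F\<close> and to assemble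
  the conclusion for \<open>Ft\<close>. The last row is transposed, so that it becomes a
  matrix-vector product.\<close>

lemma transpose_append_col_mult_eq_0_iff:
  assumes Q: "Q \<in> carrier_mat n m" and v: "v \<in> carrier_vec n" and G: "G \<in> carrier_mat n l"
  shows "transpose_mat (append_col Q v) * G = 0\<^sub>m (m + 1) l \<longleftrightarrow>
         transpose_mat Q * G = 0\<^sub>m m l \<and> transpose_mat G *\<^sub>v v = 0\<^sub>v l"
proof -
  have "transpose_mat (append_col Q v) * G = 0\<^sub>m (m + 1) l \<longleftrightarrow>
        (\<forall>k<m + 1. \<forall>j<l. (if k < m then col Q k else v) \<bullet> col G j = 0)"
    using append_col_carrier[OF Q, of v] G
    by (auto simp: mat_eq_iff col_append_col[OF Q v])
  also have "\<dots> \<longleftrightarrow> (\<forall>k<m. \<forall>j<l. col Q k \<bullet> col G j = 0) \<and> (\<forall>j<l. v \<bullet> col G j = 0)"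
    by (auto simp: less_Suc_eq)
  also have "(\<forall>j<l. v \<bullet> col G j = 0) \<longleftrightarrow> (\<forall>j<l. col G j \<bullet> v = 0)"
    using G v by (metis col_dim carrier_matD(1) comm_scalar_prod)
  also have "(\<forall>k<m. \<forall>j<l. col Q k \<bullet> col G j = 0) \<longleftrightarrow> transpose_mat Q * G = 0\<^sub>m m l"
    using Q G by (auto simp: mat_eq_iff)
  also have "(\<forall>j<l. col G j \<bullet> v = 0) \<longleftrightarrow> transpose_mat G *\<^sub>v v = 0\<^sub>v l"
    using G by (auto simp: vec_eq_iff)
  finally show ?thesis .
qed

text \<open>The Gram matrix of \<open>append_col Q v\<close> is the identity; its leading block is
  the Gram matrix of \<open>Q\<close>, and its last column above the diagonal consists of the
  products of the columns of \<open>Q\<close> with \<open>v\<close>.\<close>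

lemma orthonormal_append_colD:
  assumes Q: "Q \<in> carrier_mat n m" and v: "v \<in> carrier_vec n"
    and orth: "orthonormal_mat (append_col Q v)"
  shows "orthonormal_mat Q" and "transpose_mat Q *\<^sub>v v = 0\<^sub>v m"
proof -
  let ?P = "append_col Q v"
  note P = append_col_carrier[OF Q, of v]
  have entry: "col ?P k \<bullet> col ?P j = (if k = j then 1 else 0)" if "k < m + 1" "j < m + 1" for k j
  proof -
    have "(transpose_mat ?P * ?P) $$ (k, j) = 1\<^sub>m (m + 1) $$ (k, j)"
      using orth P unfolding orthonormal_mat_def by simp
    then show ?thesis using that P by simp
  qed
  have "col Q k \<bullet> col Q j = (if k = j then 1 else 0)" if "k < m" "j < m" for k j
    using entry[of k j] that by (simp add: col_append_col[OF Q v])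
  then show "orthonormal_mat Q"
    using Q unfolding orthonormal_mat_def by (intro eq_matI) auto
  have "col Q k \<bullet> v = 0" if "k < m" for k
    using entry[of k m] that by (simp add: col_append_col[OF Q v])
  then show "transpose_mat Q *\<^sub>v v = 0\<^sub>v m"
    using Q by (intro eq_vecI) auto
qed

lemma outer_product_carrier:
  assumes "u \<in> carrier_vec n" and "b \<in> carrier_vec m"
  shows "outer_product u b \<in> carrier_mat n m"
  using assms unfolding outer_product_def by (intro mult_carrier_mat[of _ _ 1]) auto

text \<open>Associativity, once b^T V is recognised as the single row (V^T b)^T.\<close>

lemma outer_product_mult:
  assumes u: "u \<in> carrier_vec n" and b: "b \<in> carrier_vec m" and V: "V \<in> carrier_mat m l"
  shows "outer_product u b * V = outer_product u (transpose_mat V *\<^sub>v b)"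
proof -
  have "mat_of_rows m [b] * V = mat_of_rows l [transpose_mat V *\<^sub>v b]"
    using b V by (intro eq_matI) (auto simp: mat_of_rows_index comm_scalar_prod[of b m])
  then show ?thesis
    using b V unfolding outer_product_def
    by (subst assoc_mult_mat[of _ "dim_vec u" 1 _ m _ l]) auto
qed

text \<open>Since \<^term>\<open>dim_vec (x - y) = dim_vec y\<close>, the dimension of each Lanczos vector is that of
  the vector two places before it, and \<open>q 0\<close> gets its dimension from \<open>\<beta> 0 q 0 = 0\<close>.\<close>

lemma lanczos_process_carrier:
  assumes lanczos: "lanczos_process n A k q" and "j \<le> k + 1"
  shows "q j \<in> carrier_vec n"
proof -
  from lanczos obtain \<beta> \<alpha> :: "nat \<Rightarrow> real" where q1: "q 1 \<in> carrier_vec n"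
    and q0: "\<beta> 0 \<cdot>\<^sub>v q 0 = 0\<^sub>v n"
    and step: "\<And>j. j \<in> {1..k} \<Longrightarrow> q (j + 1) = inverse (\<beta> j) \<cdot>\<^sub>v
             (A *\<^sub>v q j - \<alpha> j \<cdot>\<^sub>v q j - \<beta> (j - 1) \<cdot>\<^sub>v q (j - 1))"
    unfolding lanczos_process_def by blast
  have "dim_vec (q j) = n" using \<open>j \<le> k + 1\<close>
  proof (induction j rule: less_induct)
    case (less j)
    consider "j = 0" | "j = 1" | p where "j = p + 2"
      using le_Suc_ex[of 2 j] by (cases "2 \<le> j") (auto simp: not_le less_2_cases_iff add.commute)
    then show ?case
    proof cases
      case 1
      then show ?thesis using arg_cong[OF q0, of dim_vec] by simp
    next
      case 2
      then show ?thesis using q1 by simp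
    next
      case 3
      then have "dim_vec (q j) = dim_vec (q p)"
        using arg_cong[OF step[of "p + 1"], of dim_vec] less.prems by simp
      then show ?thesis using less 3 by simp
    qed
  qed
  then show ?thesis by (rule carrier_vecI)
qed

theorem theorem2p1:
  fixes n m l i :: nat
    and A Q T F V :: "real mat"
    and Qt Tt Ft :: "real mat"
    and q :: "nat \<Rightarrow> real vec"
    and b bt :: "real vec"
  assumes "A \<in> carrier_mat n n" and "transpose_mat A = A"
    and "krylov_like_decomposition n m i A Q T q b F"
    and "l < m"
    and "V \<in> carrier_mat m l" and "orthonormal_mat V"
    and "Qt = Q * V"
    and "Tt = transpose_mat V * T * V"
    and "bt = transpose_mat V *\<^sub>v b"
    and "Ft = Q * (1\<^sub>m m - V * transpose_mat V) * T * V + F * V"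
  shows "A * Qt = Qt * Tt + outer_product (q (i + 1)) bt + Ft \<and>
         transpose_mat (append_col Qt (q (i + 1))) * Ft = 0\<^sub>m (l + 1) l"
proof -
  define v where "v = q (i + 1)"
  \<comment> \<open>The part of \<open>T * V\<close> that projection onto the orthogonal complement
    of the range of \<open>V\<close> keeps.\<close>
  define W where "W = (1\<^sub>m m - V * transpose_mat V) * T * V"
  note V = \<open>V \<in> carrier_mat m l\<close> and A = \<open>A \<in> carrier_mat n n\<close>
  have Q: "Q \<in> carrier_mat n m" and T: "T \<in> carrier_mat m m" and b: "b \<in> carrier_vec m"
    and F: "F \<in> carrier_mat n m" and lanczos: "lanczos_process n A i q"
    and orth: "orthonormal_mat (append_col Q v)"
    and dec: "A * Q = Q * T + outer_product v b + F"
    and zero: "transpose_mat (append_col Q v) * F = 0\<^sub>m (m + 1) m"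
    using assms(3) unfolding krylov_like_decomposition_def v_def
    by blast+
  \<comment> \<open>The dimension of \<open>q (i + 1)\<close> is not stated in the decomposition; it
    comes from the Lanczos recurrence, where \<open>i + 1\<close> is the last index produced by
    \<open>i\<close> steps.\<close>
  have v: "v \<in> carrier_vec n"
    unfolding v_def by (rule lanczos_process_carrier[OF lanczos order_refl])
  have QQ: "transpose_mat Q * Q = 1\<^sub>m m" and Qv: "transpose_mat Q *\<^sub>v v = 0\<^sub>v m"
    using orthonormal_append_colD[OF Q v orth] Q by (auto simp: orthonormal_mat_def)
  have QF: "transpose_mat Q * F = 0\<^sub>m m m" and Fv: "transpose_mat F *\<^sub>v v = 0\<^sub>v m"
    using zero transpose_append_col_mult_eq_0_iff[OF Q v F] by auto
  have VV: "transpose_mat V * V = 1\<^sub>m l"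
    using \<open>orthonormal_mat V\<close> V by (simp add: orthonormal_mat_def)
  have V_tr: "transpose_mat V \<in> carrier_mat l m" and Q_tr: "transpose_mat Q \<in> carrier_mat m n"
    and F_tr: "transpose_mat F \<in> carrier_mat m n" using V Q F by auto
  have TV: "T * V \<in> carrier_mat m l" and VVt: "V * transpose_mat V \<in> carrier_mat m m"
    and QV: "Q * V \<in> carrier_mat n l" and FV: "F * V \<in> carrier_mat n l"
    and VTV: "transpose_mat V * (T * V) \<in> carrier_mat l l"
    and QT: "Q * T \<in> carrier_mat n m"
    using V_tr V T Q F by auto
  note Out = outer_product_carrier[OF v b]
  have W_eq: "W = T * V - V * (transpose_mat V * (T * V))"
  proof -
    have "W = (1\<^sub>m m - V * transpose_mat V) * (T * V)"
      unfolding W_def by (rule assoc_mult_mat) (use VVt T V in auto)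
    also have "\<dots> = 1\<^sub>m m * (T * V) - V * transpose_mat V * (T * V)"
      by (rule minus_mult_distrib_mat) (use VVt TV in auto)
    finally show ?thesis unfolding left_mult_one_mat[OF TV] assoc_mult_mat[OF V V_tr TV] .
  qed
  have W: "W \<in> carrier_mat m l" unfolding W_def using T V by auto
  have QW: "Q * W \<in> carrier_mat n l" using Q W by auto
  have Ft_eq: "Ft = Q * W + F * V"
    using assms(10) Q T V unfolding W_def
    by (smt (verit) VVt assoc_mult_mat minus_carrier_mat mult_carrier_mat)
  have FtC: "Ft \<in> carrier_mat n l" using Ft_eq QW FV by auto

  \<comment> \<open>V^T (I - V V^T) = 0, as V^T V = I.\<close>
  have VW: "transpose_mat V * W = 0\<^sub>m l l"
  proof -
    have "transpose_mat V * W =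
        transpose_mat V * (T * V) - transpose_mat V * (V * (transpose_mat V * (T * V)))"
      unfolding W_eq by (rule mult_minus_distrib_mat) (use V V_tr TV VTV in auto)
    also have "\<dots> = 0\<^sub>m l l"
      using assoc_mult_mat[OF V_tr V VTV] VV left_mult_one_mat[OF VTV] VTV by simp
    finally show ?thesis .
  qed
  have QtTt: "Qt * Tt \<in> carrier_mat n l"
    using QV T V V_tr assms(7,8) by auto
  have "A * Qt = Qt * Tt + outer_product v bt + Ft"
  proof -
    have "A * Qt = (Q * T + outer_product v b + F) * V"
      using assms(7) dec assoc_mult_mat[OF A Q V] by simp
    also have "\<dots> = Q * (T * V) + outer_product v bt + F * V"
      using add_mult_distrib_mat[of "Q * T + outer_product v b" n m F V l]
        add_mult_distrib_mat[OF QT Out V] assoc_mult_mat[OF Q T V]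
        outer_product_mult[OF v b V] assms(9) F V QT Out by simp
    also have "Q * (T * V) = Qt * Tt + Q * W"
    proof -
      have "Q * W = Q * (T * V) - Q * (V * (transpose_mat V * (T * V)))"
        unfolding W_eq by (rule mult_minus_distrib_mat) (use Q V TV VTV in auto)
      also have "Q * (V * (transpose_mat V * (T * V))) = Qt * Tt"
        using assms(7,8) assoc_mult_mat[OF Q V VTV] assoc_mult_mat[OF V_tr T V] by simp
      finally have QW_eq: "Q * W = Q * (T * V) - Qt * Tt" .
      \<comment> \<open>This cancellation needs equal dimensions, hence the carrier
        assumptions.\<close>
      have "Y = Z + (Y - Z)" if "Y \<in> carrier_mat n l" "Z \<in> carrier_mat n l" for Y Z :: "real mat"
        using that by (intro eq_matI) auto
      then show ?thesis unfolding QW_eq using mult_carrier_mat[OF Q TV] QtTt by blast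
    qed
    also have "Qt * Tt + Q * W + outer_product v bt + F * V
        = Qt * Tt + outer_product v bt + Ft"
    proof -
      have "X + Y + Z + U = X + Z + (Y + U)"
        if "X \<in> carrier_mat n l" "Y \<in> carrier_mat n l" "Z \<in> carrier_mat n l" "U \<in> carrier_mat n l"
        for X Y Z U :: "real mat"
        using that by (intro eq_matI) auto
      moreover have "outer_product v bt \<in> carrier_mat n l"
        using outer_product_carrier[OF v mult_mat_vec_carrier[OF V_tr b]] assms(9) by simp
      ultimately show ?thesis
        unfolding Ft_eq using QtTt QW FV by blast
    qed
    finally show ?thesis .
  qed
  moreover have "transpose_mat Qt * Ft = 0\<^sub>m l l"
  proof -
    have "transpose_mat Q * Ft = transpose_mat Q * (Q * W) + transpose_mat Q * (F * V)"
      unfolding Ft_eq by (rule mult_add_distrib_mat[OF Q_tr QW FV])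
    also have "\<dots> = W"
      unfolding assoc_mult_mat[OF Q_tr Q W, symmetric] assoc_mult_mat[OF Q_tr F V, symmetric]
        QQ QF left_mult_one_mat[OF W] left_mult_zero_mat[OF V] right_add_zero_mat[OF W] ..
    \<comment> \<open>The transpose of \<open>Qt\<close> is V^T Q^T, so only V^T W = 0
      remains.\<close>
    finally have "transpose_mat Q * Ft = W" .
    then show ?thesis
      using assms(7) transpose_mult[OF Q V] assoc_mult_mat[OF V_tr Q_tr FtC] VW by simp
  qed
  \<comment> \<open>Each summand ends in a factor that kills \<open>v\<close>: Q^T in the first, F^T
    in the second.\<close>
  moreover have "transpose_mat Ft *\<^sub>v v = 0\<^sub>v l"
  proof -
    have "transpose_mat Ft
        = transpose_mat W * transpose_mat Q + transpose_mat V * transpose_mat F"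
      unfolding Ft_eq using transpose_add[OF QW FV] transpose_mult[OF Q W] transpose_mult[OF F V]
      by simp
    also have "\<dots> *\<^sub>v v = (transpose_mat W * transpose_mat Q) *\<^sub>v v
        + (transpose_mat V * transpose_mat F) *\<^sub>v v"
      by (rule add_mult_distrib_mat_vec) (use W Q V F v in auto)
    also have "(transpose_mat W * transpose_mat Q) *\<^sub>v v = 0\<^sub>v l"
      using assoc_mult_mat_vec[of "transpose_mat W" l m "transpose_mat Q" n v] W Q_tr v Qv
      by (auto intro!: eq_vecI)
    also have "(transpose_mat V * transpose_mat F) *\<^sub>v v = 0\<^sub>v l"
      using assoc_mult_mat_vec[OF V_tr F_tr v] Fv V by (auto intro!: eq_vecI)
    finally show ?thesis by simp
  qed
  ultimately show ?thesis
    using transpose_append_col_mult_eq_0_iff[OF _ v FtC, of Qt l] QV assms(7)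
    unfolding v_def by simp
qed

end
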